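(* Let $K>0$ and let $f:[0,\infty)\to[0,\infty)$ be continuous with $f(0)=0$, $f(x)>0$ for all $x>0$, with only two fixed points $0$ and $K$, and with $f(x)>x$ for all $0<x<K$ and $f(x)<x$ for all $x>K$. Let $(\xi_n)_{n\ge1}$ be independent identically distributed random variables with a density $\phi$ such that $\phi(x)>0$ for $x\in(-1,1)$, $\phi(x)=0$ for $x\notin[-1,1]$, and $\phi(x)=\phi(-x)$ for all $x\in[-1,1]$. Let $\sigma_n>0$, $n\ge0$, with $\sum_n\sigma_n^2<\infty$. Let $(x_n)$ be the solution of $$x_{n+1}=\max\{f(x_n)+\sigma_n\xi_{n+1},0\},\quad n=0,1,\dots,$$ with initial value $x_0>0$. Then $$\mathbb P\{\omega:\lim_{n\to\infty}x_n(\omega)=0\}\le\frac12.$$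
   Context: All random variables are defined on a common complete probability space $(\Omega,\mathcal F,\mathbb P)$. *)

theory Defs
  imports "HOL-Probability.Probability"
begin

end

theory Submission
  imports Defs
begin

text \<open>
  Near \<open>0\<close> we have \<open>f u \<ge> u\<close>, so a path converging to \<open>0\<close> satisfies, from some time \<open>m\<close> on,
  \<open>x n \<ge> x m + S\<close> with \<open>S\<close> the noise accumulated between \<open>m\<close> and \<open>n\<close>. As \<open>x n\<close> tends to \<open>0\<close> and
  \<open>x m \<ge> 0\<close>, the partial sums of the noise from \<open>m\<close> on have a nonpositive limes superior. The law
  of the noise is symmetric, so this event has the same probability as the event for the negated
  noise; both can only occur together if the partial sums tend to \<open>0\<close>, which has probability \<open>0\<close>
  because the first summand has no atoms and is independent of the others.
\<close>

text \<open>Negation turns the limes superior into minus the limes inferior, so the two bounds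
  squeeze both limits to 0.\<close>

lemma tendsto_0_if_limsup_le_0:
  fixes S :: "nat \<Rightarrow> real"
  assumes "limsup (\<lambda>n. ereal (S n)) \<le> 0" and "limsup (\<lambda>n. ereal (- S n)) \<le> 0"
  shows "S \<longlonglongrightarrow> 0"
proof -
  have "limsup (\<lambda>n. ereal (- S n)) = - liminf (\<lambda>n. ereal (S n))"
    using ereal_Limsup_uminus[of sequentially "\<lambda>n. ereal (S n)"] by simp
  with assms(2) have ge: "0 \<le> liminf (\<lambda>n. ereal (S n))"
    by simp
  have "liminf (\<lambda>n. ereal (S n)) \<le> limsup (\<lambda>n. ereal (S n))"
    by (rule Liminf_le_Limsup) simp
  with ge assms(1) have "liminf (\<lambda>n. ereal (S n)) = 0" "limsup (\<lambda>n. ereal (S n)) = 0"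
    by auto
  then have "(\<lambda>n. ereal (S n)) \<longlonglongrightarrow> 0"
    by (intro Liminf_eq_Limsup) auto
  then show ?thesis
    by (simp add: zero_ereal_def)
qed

context prob_space
begin

text \<open>By independence the joint law is a product measure. By Fubini the diagonal has as
  measure the integral of its horizontal sections, each a single point of mass 0 under the law of
  \<open>X\<close>.\<close>

lemma prob_indep_var_eq_0:
  fixes X Y :: "'a \<Rightarrow> real"
  assumes ind: "indep_var borel X borel Y"
    and atomless: "\<And>c. prob {\<omega> \<in> space M. X \<omega> = c} = 0"
  shows "prob {\<omega> \<in> space M. X \<omega> = Y \<omega>} = 0"
proof -
  have [measurable]: "random_variable borel X" "random_variable borel Y"
    using ind by (auto dest: indep_var_rv1 indep_var_rv2)
  interpret X: prob_space "distr M borel X" by (rule prob_space_distr) simp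
  interpret Y: prob_space "distr M borel Y" by (rule prob_space_distr) simp
  interpret pair_sigma_finite "distr M borel X" "distr M borel Y" ..
  define D where "D = {p \<in> space (borel \<Otimes>\<^sub>M borel). fst p = (snd p :: real)}"
  have D [measurable]: "D \<in> sets (borel \<Otimes>\<^sub>M borel)"
    unfolding D_def by measurable
  have "emeasure M {\<omega> \<in> space M. X \<omega> = Y \<omega>}
      = emeasure (distr M (borel \<Otimes>\<^sub>M borel) (\<lambda>\<omega>. (X \<omega>, Y \<omega>))) D"
  proof -
    have "(\<lambda>\<omega>. (X \<omega>, Y \<omega>)) -` D \<inter> space M = {\<omega> \<in> space M. X \<omega> = Y \<omega>}"
      by (auto simp: D_def space_pair_measure)
    then show ?thesis
      by (simp add: emeasure_distr)
  qed
  also have "\<dots> = emeasure (distr M borel X \<Otimes>\<^sub>M distr M borel Y) D"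
    using ind by (simp add: indep_var_distribution_eq)
  also have "\<dots> = (\<integral>\<^sup>+y. emeasure (distr M borel X) ((\<lambda>x. (x, y)) -` D) \<partial>distr M borel Y)"
    by (rule emeasure_pair_measure_alt2) simp
  also have "\<dots> = (\<integral>\<^sup>+y. 0 \<partial>distr M borel Y)"
  proof (rule nn_integral_cong)
    fix y :: real
    have "(\<lambda>x. (x, y)) -` D = {y}"
      by (auto simp: D_def space_pair_measure)
    moreover have "emeasure (distr M borel X) {y} = emeasure M {\<omega> \<in> space M. X \<omega> = y}"
      by (subst emeasure_distr) (auto intro!: arg_cong[where f="emeasure M"])
    ultimately show "emeasure (distr M borel X) ((\<lambda>x. (x, y)) -` D) = 0"
      by (simp add: emeasure_eq_measure atomless)
  qed
  finally show ?thesis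
    by (simp add: emeasure_eq_measure)
qed

text \<open>The law of an independent family is the product of its marginals, and each marginal is
  symmetric. Symmetry is needed for the law of the whole sequence because it is applied to an event
  that depends on all coordinates.\<close>

lemma distr_indep_vars_uminus:
  fixes X :: "'i \<Rightarrow> 'a \<Rightarrow> real"
  assumes ind: "indep_vars (\<lambda>_. borel) X UNIV"
    and sym: "\<And>i. distr M borel (\<lambda>\<omega>. - X i \<omega>) = distr M borel (X i)"
  shows "distr M (\<Pi>\<^sub>M i\<in>UNIV. borel) (\<lambda>\<omega> i. - X i \<omega>) = distr M (\<Pi>\<^sub>M i\<in>UNIV. borel) (\<lambda>\<omega> i. X i \<omega>)"
proof -
  have rv: "random_variable borel (X i)" for i
    using ind by (simp add: indep_vars_def2)
  have ind': "indep_vars (\<lambda>_. borel) (\<lambda>i \<omega>. - X i \<omega>) UNIV"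
    by (rule indep_vars_compose2[OF ind]) simp
  have "distr M (\<Pi>\<^sub>M i\<in>UNIV. borel) (\<lambda>\<omega>. \<lambda>i\<in>UNIV. - X i \<omega>)
      = (\<Pi>\<^sub>M i\<in>UNIV. distr M borel (\<lambda>\<omega>. - X i \<omega>))"
    using ind' rv by (subst (asm) indep_vars_iff_distr_eq_PiM) auto
  also have "\<dots> = distr M (\<Pi>\<^sub>M i\<in>UNIV. borel) (\<lambda>\<omega>. \<lambda>i\<in>UNIV. X i \<omega>)"
    using ind rv by (subst (asm) indep_vars_iff_distr_eq_PiM) (auto simp: sym)
  finally show ?thesis
    by (simp add: restrict_def)
qed

text \<open>If the series sums to 0, then \<open>X 0\<close> equals minus the sum of the later
  terms, a quantity independent of \<open>X 0\<close>.\<close>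

lemma prob_sums_0_eq_0:
  fixes X :: "nat \<Rightarrow> 'a \<Rightarrow> real"
  assumes ind: "indep_vars (\<lambda>_. borel) X UNIV"
    and atomless: "\<And>c. prob {\<omega> \<in> space M. X 0 \<omega> = c} = 0"
  shows "prob {\<omega> \<in> space M. (\<lambda>n. X n \<omega>) sums 0} = 0"
proof -
  have [measurable]: "random_variable borel (X i)" for i
    using ind by (simp add: indep_vars_def2)
  \<comment> \<open>\<open>lim\<close> is total: on divergent tails it has some unspecified value,
    which is harmless, since \<open>Y\<close> stays measurable and its value matters only where the
    tail converges.\<close>
  define Y where "Y = (\<lambda>v::nat \<Rightarrow> real. - lim (\<lambda>n. \<Sum>i<n. v (Suc i)))"
  have [measurable]: "Y \<in> borel_measurable (\<Pi>\<^sub>M i\<in>{1..}. borel)"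
    unfolding Y_def by measurable
  have "indep_var (\<Pi>\<^sub>M i\<in>{0}. borel) (\<lambda>\<omega>. \<lambda>i\<in>{0}. X i \<omega>)
      (\<Pi>\<^sub>M i\<in>{1..}. borel) (\<lambda>\<omega>. \<lambda>i\<in>{1..}. X i \<omega>)"
    by (rule indep_var_restrict[OF ind]) auto
  then have "indep_var borel ((\<lambda>v. v 0) \<circ> (\<lambda>\<omega>. \<lambda>i\<in>{0}. X i \<omega>))
      borel (Y \<circ> (\<lambda>\<omega>. \<lambda>i\<in>{1..}. X i \<omega>))"
    by (rule indep_var_compose; measurable)
  then have "indep_var borel (X 0) borel (\<lambda>\<omega>. - lim (\<lambda>n. \<Sum>i<n. X (Suc i) \<omega>))"
    by (simp add: comp_def Y_def)
  from prob_indep_var_eq_0[OF this atomless]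
  have "prob {\<omega> \<in> space M. X 0 \<omega> = - lim (\<lambda>n. \<Sum>i<n. X (Suc i) \<omega>)} = 0" .
  moreover have "prob {\<omega> \<in> space M. (\<lambda>n. X n \<omega>) sums 0}
      \<le> prob {\<omega> \<in> space M. X 0 \<omega> = - lim (\<lambda>n. \<Sum>i<n. X (Suc i) \<omega>)}"
  proof (rule finite_measure_mono)
    show "{\<omega> \<in> space M. (\<lambda>n. X n \<omega>) sums 0}
        \<subseteq> {\<omega> \<in> space M. X 0 \<omega> = - lim (\<lambda>n. \<Sum>i<n. X (Suc i) \<omega>)}"
    proof safe
      fix \<omega> assume "(\<lambda>n. X n \<omega>) sums 0"
      then have "(\<lambda>n. X (Suc n) \<omega>) sums (- X 0 \<omega>)"
        using sums_Suc_iff[of "\<lambda>n. X n \<omega>" "- X 0 \<omega>"] by simp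
      then show "X 0 \<omega> = - lim (\<lambda>n. \<Sum>i<n. X (Suc i) \<omega>)"
        by (simp add: sums_def limI)
    qed
  qed measurable
  ultimately show ?thesis
    by (simp add: measure_le_0_iff)
qed

lemma prob_limsup_partial_sums_le_half:
  fixes X :: "nat \<Rightarrow> 'a \<Rightarrow> real"
  assumes ind: "indep_vars (\<lambda>_. borel) X UNIV"
    and sym: "\<And>i. distr M borel (\<lambda>\<omega>. - X i \<omega>) = distr M borel (X i)"
    and atomless: "\<And>c. prob {\<omega> \<in> space M. X 0 \<omega> = c} = 0"
  shows "prob {\<omega> \<in> space M. limsup (\<lambda>n. ereal (\<Sum>i<n. X i \<omega>)) \<le> 0} \<le> 1 / 2"
proof -
  have rv [measurable]: "random_variable borel (X i)" for i
    using ind by (simp add: indep_vars_def2)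
  define P where "P = (\<Pi>\<^sub>M i\<in>(UNIV :: nat set). (borel :: real measure))"
  \<comment> \<open>Stated as a set of sequences, so that \<open>A\<close> and \<open>B\<close>
    below are preimages of the same set under two maps with the same law.\<close>
  define G where "G = {v \<in> space P. limsup (\<lambda>n. ereal (\<Sum>i<n. v i)) \<le> 0}"
  have [measurable]: "G \<in> sets P"
    unfolding G_def P_def by measurable
  have [measurable]: "(\<lambda>\<omega> i. X i \<omega>) \<in> measurable M P" "(\<lambda>\<omega> i. - X i \<omega>) \<in> measurable M P"
    unfolding P_def by (auto intro!: measurable_PiM_single')
  define A where "A = {\<omega> \<in> space M. limsup (\<lambda>n. ereal (\<Sum>i<n. X i \<omega>)) \<le> 0}"
  define B where "B = {\<omega> \<in> space M. limsup (\<lambda>n. ereal (\<Sum>i<n. - X i \<omega>)) \<le> 0}"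
  have [measurable]: "A \<in> events" "B \<in> events"
    unfolding A_def B_def by measurable
  have "prob A = measure (distr M P (\<lambda>\<omega> i. X i \<omega>)) G"
  proof -
    have "(\<lambda>\<omega> i. X i \<omega>) -` G \<inter> space M = A"
      by (auto simp: A_def G_def P_def space_PiM)
    then show ?thesis
      by (simp add: measure_distr)
  qed
  moreover have "prob B = measure (distr M P (\<lambda>\<omega> i. - X i \<omega>)) G"
  proof -
    have "(\<lambda>\<omega> i. - X i \<omega>) -` G \<inter> space M = B"
      by (auto simp: B_def G_def P_def space_PiM)
    then show ?thesis
      by (simp add: measure_distr)
  qed
  ultimately have "prob B = prob A"
    unfolding P_def by (simp add: distr_indep_vars_uminus[OF ind sym])
  moreover have "prob (A \<inter> B) = 0"
  proof -
    have "prob (A \<inter> B) \<le> prob {\<omega> \<in> space M. (\<lambda>n. X n \<omega>) sums 0}"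
    proof (rule finite_measure_mono)
      show "A \<inter> B \<subseteq> {\<omega> \<in> space M. (\<lambda>n. X n \<omega>) sums 0}"
        unfolding A_def B_def sums_def by (auto intro!: tendsto_0_if_limsup_le_0 simp: sum_negf)
      show "{\<omega> \<in> space M. (\<lambda>n. X n \<omega>) sums 0} \<in> events"
        unfolding sums_def by measurable
    qed
    then show ?thesis
      using prob_sums_0_eq_0[OF ind atomless] by (simp add: measure_le_0_iff)
  qed
  \<comment> \<open>Inclusion-exclusion: two events of equal probability that overlap in a null set
    cannot exceed 1/2 each.\<close>
  moreover have "prob (A \<union> B) + prob (A \<inter> B) = prob A + prob B"
    using finite_measure_Union'[of A B] finite_measure_Diff'[of B A] by (simp add: Int_commute)
  ultimately have "2 * prob A \<le> 1"
    using prob_le_1[of "A \<union> B"] by linarith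
  then show ?thesis
    by (simp add: A_def)
qed

lemma prob_eq_const_eq_0:
  fixes X :: "'a \<Rightarrow> real"
  assumes "distributed M lborel X g"
  shows "prob {\<omega> \<in> space M. X \<omega> = c} = 0"
proof -
  have "emeasure M (X -` {c} \<inter> space M) = (\<integral>\<^sup>+u. g u * indicator {c} u \<partial>lborel)"
    using distributed_emeasure[OF assms, of "{c}"] by simp
  also have "\<dots> = 0"
    by (intro nn_integral_null_set countable_imp_null_set_lborel) simp
  finally have "emeasure M (X -` {c} \<inter> space M) = 0" .
  moreover have "X -` {c} \<inter> space M = {\<omega> \<in> space M. X \<omega> = c}"
    by auto
  ultimately show ?thesis
    by (simp add: emeasure_eq_measure)
qed

lemma distr_uminus_if_even_density:
  fixes X :: "'a \<Rightarrow> real"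
  assumes X: "distributed M lborel X g" and even: "\<And>u. g (- u) = g u"
  shows "distr M borel (\<lambda>\<omega>. - X \<omega>) = distr M borel X"
proof -
  have "distributed M lborel (\<lambda>\<omega>. - X \<omega>) g"
    \<comment> \<open>An affine change of variables with slope -1 replaces the density by its
      reflection.\<close>
    using distributed_affine[OF X, of "-1" 0] by (simp add: even divide_ennreal_def)
  then have "distr M lborel (\<lambda>\<omega>. - X \<omega>) = distr M lborel X"
    using X by (simp add: distributed_def)
  then show ?thesis
    by (simp cong: distr_cong)
qed

end

theorem lemma5p8:
  fixes M :: "'a measure"
    and K x0 :: real
    and f \<phi> :: "real \<Rightarrow> real"
    and \<sigma> :: "nat \<Rightarrow> real"
    and \<xi> x :: "nat \<Rightarrow> 'a \<Rightarrow> real"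
  assumes "prob_space M"
    and "complete_measure M"
    and "K > 0"
    and "continuous_on {0..} f"
    and "\<And>u. u \<ge> 0 \<Longrightarrow> f u \<ge> 0"
    and "f 0 = 0"
    and "\<And>u. u > 0 \<Longrightarrow> f u > 0"
    and "{u. u \<ge> 0 \<and> f u = u} = {0, K}"
    and "\<And>u. 0 < u \<Longrightarrow> u < K \<Longrightarrow> f u > u"
    and "\<And>u. u > K \<Longrightarrow> f u < u"
    and "prob_space.indep_vars M (\<lambda>_. borel) \<xi> {1..}"
    and "\<And>u. \<phi> u \<ge> 0"
    and "\<And>n. n \<ge> 1 \<Longrightarrow> distributed M lborel (\<xi> n) (\<lambda>u. ennreal (\<phi> u))"
    and "\<And>u. u \<in> {-1<..<1} \<Longrightarrow> \<phi> u > 0"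
    and "\<And>u. u \<notin> {-1..1} \<Longrightarrow> \<phi> u = 0"
    and "\<And>u. u \<in> {-1..1} \<Longrightarrow> \<phi> u = \<phi> (- u)"
    and "\<And>n. \<sigma> n > 0"
    and "summable (\<lambda>n. (\<sigma> n)\<^sup>2)"
    and "x0 > 0"
    and "\<And>\<omega>. \<omega> \<in> space M \<Longrightarrow> x 0 \<omega> = x0"
    and "\<And>n \<omega>. \<omega> \<in> space M \<Longrightarrow>
           x (Suc n) \<omega> = max (f (x n \<omega>) + \<sigma> n * \<xi> (Suc n) \<omega>) 0"
  shows "measure M {\<omega> \<in> space M. (\<lambda>n. x n \<omega>) \<longlonglongrightarrow> 0} \<le> 1 / 2"
proof -
  interpret prob_space M by fact
  note pos = \<open>\<And>n. \<sigma> n > 0\<close>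
  note dens = \<open>\<And>n. n \<ge> 1 \<Longrightarrow> distributed M lborel (\<xi> n) (\<lambda>u. ennreal (\<phi> u))\<close>
  note step = \<open>\<And>n \<omega>. \<omega> \<in> space M \<Longrightarrow>
    x (Suc n) \<omega> = max (f (x n \<omega>) + \<sigma> n * \<xi> (Suc n) \<omega>) 0\<close>
  \<comment> \<open>Symmetry is assumed on [-1,1] only; outside, both values vanish.\<close>
  have even: "\<phi> (- u) = \<phi> u" for u
    using assms(15)[of u] assms(15)[of "- u"] assms(16)[of u] by (cases "u \<in> {-1..1}") auto
  \<comment> \<open>\<open>X m i\<close> is the noise entering the step from time
    \<open>m + i\<close> to the next one.\<close>
  define X where "X = (\<lambda>m i \<omega>. \<sigma> (m + i) * \<xi> (Suc (m + i)) \<omega>)"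
  define G where "G = (\<lambda>m. {\<omega> \<in> space M. limsup (\<lambda>n. ereal (\<Sum>i<n. X m i \<omega>)) \<le> 0})"
  have rv [measurable]: "random_variable borel (\<xi> (Suc n))" for n
    using distributed_measurable[OF dens[of "Suc n"]] by simp
  have [measurable]: "random_variable borel (X m i)" for m i
    unfolding X_def by measurable
  have [measurable]: "G m \<in> events" for m
    unfolding G_def by measurable
  have G_le: "prob (G m) \<le> 1 / 2" for m
    unfolding G_def
  proof (rule prob_limsup_partial_sums_le_half)
    \<comment> \<open>Reindexing: the noise is cut into disjoint one-element blocks indexed by
      \<open>j\<close>, and the only coordinate of each block is then read off.\<close>
    have "indep_vars (\<lambda>j. \<Pi>\<^sub>M i\<in>{Suc (m + j)}. borel) (\<lambda>j \<omega>. \<lambda>i\<in>{Suc (m + j)}. \<xi> i \<omega>) UNIV"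
      by (rule indep_vars_restrict[OF assms(11)]) (auto simp: disjoint_family_on_def)
    then have "indep_vars (\<lambda>_. borel) (\<lambda>j \<omega>. (\<lambda>i\<in>{Suc (m + j)}. \<xi> i \<omega>) (Suc (m + j))) UNIV"
      by (rule indep_vars_compose2[where Y="\<lambda>j v. v (Suc (m + j))"]) auto
    then have "indep_vars (\<lambda>_. borel) (\<lambda>j. \<xi> (Suc (m + j))) UNIV"
      by simp
    then show "indep_vars (\<lambda>_. borel) (X m) UNIV"
      unfolding X_def by (rule indep_vars_compose2) auto
    show "distr M borel (\<lambda>\<omega>. - X m i \<omega>) = distr M borel (X m i)" for i
    proof -
      let ?c = "\<sigma> (m + i)" and ?\<zeta> = "\<xi> (Suc (m + i))"
      have "distr M borel (\<lambda>\<omega>. - X m i \<omega>) = distr (distr M borel (\<lambda>\<omega>. - ?\<zeta> \<omega>)) borel ((*) ?c)"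
        by (subst distr_distr) (auto simp: X_def comp_def)
      also have "\<dots> = distr (distr M borel ?\<zeta>) borel ((*) ?c)"
        using distr_uminus_if_even_density[OF dens[of "Suc (m + i)"]] by (simp add: even)
      also have "\<dots> = distr M borel (X m i)"
        by (subst distr_distr) (auto simp: X_def comp_def)
      finally show ?thesis .
    qed
    show "prob {\<omega> \<in> space M. X m 0 \<omega> = c} = 0" for c
    proof -
      have "{\<omega> \<in> space M. X m 0 \<omega> = c} = {\<omega> \<in> space M. \<xi> (Suc m) \<omega> = c / \<sigma> m}"
        using pos[of m] by (auto simp: X_def field_simps)
      then show ?thesis
        using prob_eq_const_eq_0[OF dens[of "Suc m"]] by simp
    qed
  qed
  \<comment> \<open>The events \<open>G m\<close> need not be monotone in \<open>m\<close>, so a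
    bound on each says nothing about their union. The events \<open>H m\<close> increase, and
    continuity from below carries the bound 1/2 over to their union.\<close>
  define H where "H = (\<lambda>m. \<Inter>j\<in>{m..}. G j)"
  have [measurable]: "H m \<in> events" for m
    unfolding H_def by measurable
  have "prob (H m) \<le> 1 / 2" for m
    by (rule order_trans[OF finite_measure_mono G_le[of m]]) (auto simp: H_def)
  moreover have "(\<lambda>m. prob (H m)) \<longlonglongrightarrow> prob (\<Union>m. H m)"
    by (rule finite_Lim_measure_incseq) (auto simp: H_def incseq_def)
  ultimately have "prob (\<Union>m. H m) \<le> 1 / 2"
    by (intro LIMSEQ_le_const2) auto
  moreover have "{\<omega> \<in> space M. (\<lambda>n. x n \<omega>) \<longlonglongrightarrow> 0} \<subseteq> (\<Union>m. H m)"
  proof safe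
    fix \<omega> assume \<omega>: "\<omega> \<in> space M" and lim: "(\<lambda>n. x n \<omega>) \<longlonglongrightarrow> 0"
    have nonneg: "x n \<omega> \<ge> 0" for n
      using \<omega> assms(19,20) step by (cases n) auto
    \<comment> \<open>From time \<open>m\<close> on the path stays in [0,\<open>K\<close>), where
      \<open>f u\<close> is at least \<open>u\<close>.\<close>
    obtain m where m: "\<And>n. n \<ge> m \<Longrightarrow> x n \<omega> < K"
      using order_tendstoD(2)[OF lim \<open>K > 0\<close>] by (auto simp: eventually_sequentially)
    have "\<omega> \<in> G j" if "j \<ge> m" for j
    proof -
      \<comment> \<open>Each step adds at least its noise term: \<open>f\<close> does not lower the
        path here, and truncation at 0 can only raise it.\<close>
      have grow: "x j \<omega> + (\<Sum>i<n. X j i \<omega>) \<le> x (j + n) \<omega>" for n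
      proof (induction n)
        case (Suc n)
        have "x (j + n) \<omega> \<le> f (x (j + n) \<omega>)"
          using nonneg[of "j + n"] m[of "j + n"] that \<open>f 0 = 0\<close> assms(9)[of "x (j + n) \<omega>"]
          by (cases "x (j + n) \<omega> = 0") auto
        with Suc show ?case
          by (simp add: step[OF \<omega>] X_def)
      qed simp
      have lim0: "(\<lambda>n. ereal (x (j + n) \<omega>)) \<longlonglongrightarrow> 0"
        using LIMSEQ_ignore_initial_segment[OF lim, of j] by (simp add: zero_ereal_def add.commute)
      have "(\<Sum>i<n. X j i \<omega>) \<le> x (j + n) \<omega>" for n
        using grow[of n] nonneg[of j] by linarith
      then have "limsup (\<lambda>n. ereal (\<Sum>i<n. X j i \<omega>)) \<le> limsup (\<lambda>n. ereal (x (j + n) \<omega>))"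
        by (intro Limsup_mono) auto
      also have "\<dots> = 0"
        using lim0 by (intro lim_imp_Limsup) auto
      finally show ?thesis
        using \<omega> by (simp add: G_def)
    qed
    then show "\<omega> \<in> (\<Union>m. H m)"
      by (auto simp: H_def)
  qed
  then have "prob {\<omega> \<in> space M. (\<lambda>n. x n \<omega>) \<longlonglongrightarrow> 0} \<le> prob (\<Union>m. H m)"
    by (rule finite_measure_mono) measurable
  ultimately show ?thesis
    by linarith
qed

end
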